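(* Let $[a,b]$ be a compact interval. There exists a continuous $ACG$-function $F\colon[a,b]\to\mathbb R$ such that for every $r$ with $1\le r<\infty$ there is a set of positive Lebesgue measure at each point of which $F$ is not $L^r$-differentiable.
   Context: $L^r$-derivative: a function $F\in L^r[a,b]$ (defined at every point) is $L^r$-differentiable at $x$ if there is a real number $\alpha$ with $\left(\frac1h\int_{-h}^{h}|F(x+t)-F(x)-\alpha t|^r\,dt\right)^{1/r}=o(h)$ as $h\to0^+$. For $E\subset[a,b]$, $F\in AC(E)$ means: for each $\varepsilon>0$ there exists $\eta>0$ such that for every finite collection of nonoverlapping (no common interior points) non-degenerate closed intervals $\{[c_i,d_i]\}_i$ with endpoints in $E$ and $\sum_i(d_i-c_i)<\eta$ one has $\sum_i|F(d_i)-F(c_i)|<\varepsilon$. $F\colon[a,b]\to\mathbb R$ is an $ACG$-function if $[a,b]=\bigcup_{n=1}^\infty E_n$ for some sets $E_n$ with $F\in AC(E_n)$ for all $n$. *)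

theory Defs
  imports "HOL-Analysis.Analysis" "HOL-Library.Landau_Symbols"
begin

text \<open>
  Bochner integrals of non-integrable functions are \<open>0\<close>, so the following notion is meaningful
  only for functions that are \<open>r\<close>-integrable near \<open>x\<close>, such as functions continuous
  near \<open>x\<close>. Only the values of \<open>F\<close> in arbitrarily small neighbourhoods of \<open>x\<close>
  matter; for a function on \<open>[a, b]\<close> it is to be used at points of \<open>(a, b)\<close>.
\<close>

definition Lr_differentiable :: "real \<Rightarrow> (real \<Rightarrow> real) \<Rightarrow> real \<Rightarrow> bool" where
  "Lr_differentiable r F x \<longleftrightarrow>
     (\<exists>\<alpha>::real.
        (\<lambda>h. (1 / h * (LINT t:{-h..h}|lebesgue. \<bar>F (x + t) - F x - \<alpha> * t\<bar> powr r)) powr (1 / r))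
          \<in> o[at_right 0](\<lambda>h. h))"

text \<open>
  A finite family of intervals \<open>[c, d]\<close> is a finite set of pairs \<open>(c, d)\<close>; nothing is lost by
  disregarding repetitions, since a non-degenerate interval overlaps itself.
\<close>

definition AC_on :: "real set \<Rightarrow> (real \<Rightarrow> real) \<Rightarrow> bool" where
  "AC_on E F \<longleftrightarrow>
     (\<forall>\<epsilon>>0. \<exists>\<eta>>0. \<forall>D :: (real \<times> real) set.
        finite D \<and>
        (\<forall>(c, d)\<in>D. c \<in> E \<and> d \<in> E \<and> c < d) \<and>
        pairwise (\<lambda>(c, d) (c', d'). {c<..<d} \<inter> {c'<..<d'} = {}) D \<and>
        (\<Sum>(c, d)\<in>D. d - c) < \<eta>
        \<longrightarrow> (\<Sum>(c, d)\<in>D. \<bar>F d - F c\<bar>) < \<epsilon>)"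

definition ACG_on :: "real \<Rightarrow> real \<Rightarrow> (real \<Rightarrow> real) \<Rightarrow> bool" where
  "ACG_on a b F \<longleftrightarrow>
     (\<exists>E :: nat \<Rightarrow> real set. {a..b} = (\<Union>n. E n) \<and> (\<forall>n. AC_on (E n) F))"

end

theory Submission imports Defs
begin

text \<open>
  The function is \<open>F x = sqrt (infdist x P)\<close> for a set \<open>P\<close> of positive measure that has
  large holes next to each of its points at arbitrarily small scales.

  Every function of this form is ACG, whatever \<open>P\<close> is: the distance to \<open>P\<close> is Lipschitz, and the
  square root spoils this only near the value 0. So \<open>F\<close> is still Lipschitz on the set where the
  distance is either 0 or at least \<open>1 / (n + 1)\<close>, and these sets cover the line
  (\<open>ACG_on_sqrt_infdist\<close>).

  Now let \<open>x\<close> be a point of \<open>P\<close>, so that \<open>F x = 0\<close>, and suppose that within distance \<open>h\<close> of \<open>x\<close>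
  there is an interval of length \<open>w\<close> on which the distance to \<open>P\<close> is at least \<open>w\<close>. On this interval
  \<open>F\<close> is at least \<open>sqrt w\<close>. If \<open>sqrt w\<close> is much larger than \<open>h\<close>, then no linear function
  \<open>\<alpha> * t\<close> can compensate for this, and the \<open>r\<close>-th mean of the error over \<open>[x - h, x + h]\<close> is
  at least of the order of \<open>(w / h) powr (1 / r) * sqrt w\<close>, hence of \<open>(w / h) * sqrt w\<close>. So \<open>F\<close> is
  not \<open>L\<^sup>r\<close>-differentiable at \<open>x\<close>, for any \<open>r \<ge> 1\<close>, as soon as \<open>w * sqrt w / h\<^sup>2\<close> tends to
  infinity along some scales \<open>h\<close> that tend to 0 (\<open>not_Lr_differentiable_sqrt_infdist\<close>).

  This asks for \<open>w\<close> to be large compared with \<open>h powr (4 / 3)\<close>, which leaves room for \<open>P\<close> to have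
  positive measure: about \<open>1 / h\<close> holes of length \<open>w\<close> serve all the points of \<open>[a, b]\<close> at the
  scale \<open>h\<close>, so it is enough that the ratios \<open>w / h\<close> have a small sum. Any \<open>w\<close> of order
  \<open>h powr \<gamma>\<close> with \<open>1 < \<gamma> < 4 / 3\<close> works along geometric scales. The choice here is
  \<open>\<gamma> = 6 / 5\<close>, with \<open>h\<close> of order \<open>1 / 32 ^ n\<close> and \<open>w\<close> of order \<open>1 / 64 ^ n\<close>: then \<open>w / h\<close> is
  of order \<open>1 / 2 ^ n\<close> and \<open>w * sqrt w / h\<^sup>2\<close> of order \<open>1024 ^ n / 512 ^ n = 2 ^ n\<close>.
\<close>

section \<open>Square roots of distance functions are ACG\<close>

lemma lipschitz_on_imp_AC_on:
  fixes F :: "real \<Rightarrow> real"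
  assumes "C-lipschitz_on E F"
  shows "AC_on E F"
  unfolding AC_on_def
proof (intro allI impI)
  fix \<epsilon> :: real assume "\<epsilon> > 0"
  have C: "C \<ge> 0" using assms by (rule lipschitz_on_nonneg)
  show "\<exists>\<eta>>0. \<forall>D. finite D \<and>
        (\<forall>(c, d)\<in>D. c \<in> E \<and> d \<in> E \<and> c < d) \<and>
        pairwise (\<lambda>(c, d) (c', d'). {c<..<d} \<inter> {c'<..<d'} = {}) D \<and>
        (\<Sum>(c, d)\<in>D. d - c) < \<eta>
        \<longrightarrow> (\<Sum>(c, d)\<in>D. \<bar>F d - F c\<bar>) < \<epsilon>"
  proof (intro exI[of _ "\<epsilon> / (C + 1)"] conjI allI impI; (elim conjE)?)
    show "\<epsilon> / (C + 1) > 0" using \<open>\<epsilon> > 0\<close> C by simp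
    fix D :: "(real \<times> real) set"
    assume D: "\<forall>(c, d)\<in>D. c \<in> E \<and> d \<in> E \<and> c < d"
      and small: "(\<Sum>(c, d)\<in>D. d - c) < \<epsilon> / (C + 1)"
    have "(\<Sum>(c, d)\<in>D. \<bar>F d - F c\<bar>) \<le> (\<Sum>(c, d)\<in>D. C * (d - c))"
    proof (rule sum_mono, clarify)
      fix c d assume "(c, d) \<in> D"
      then have "c \<in> E" "d \<in> E" "c < d" using D by auto
      then show "\<bar>F d - F c\<bar> \<le> C * (d - c)"
        using lipschitz_onD[OF assms, of d c] by (simp add: dist_real_def)
    qed
    also have "\<dots> = C * (\<Sum>(c, d)\<in>D. d - c)"
      by (simp add: sum_distrib_left case_prod_unfold)
    also have "\<dots> \<le> C * (\<epsilon> / (C + 1))"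
      using small C by (intro mult_left_mono) auto
    also have "\<dots> < \<epsilon>" using C \<open>\<epsilon> > 0\<close> by (simp add: field_simps)
    finally show "(\<Sum>(c, d)\<in>D. \<bar>F d - F c\<bar>) < \<epsilon>" .
  qed
qed

text \<open>
  The square root is Lipschitz as long as one of the two arguments stays away from 0; the other
  one may be 0. This is what allows \<open>P\<close> itself to belong to every piece of the decomposition below.
\<close>

lemma abs_sqrt_diff_le:
  fixes u v c :: real
  assumes "u \<ge> 0" "v \<ge> 0" "c > 0" "u = v \<or> c \<le> sqrt u + sqrt v"
  shows "\<bar>sqrt u - sqrt v\<bar> \<le> \<bar>u - v\<bar> / c"
proof (cases "u = v")
  case False
  have "c * \<bar>sqrt u - sqrt v\<bar> \<le> (sqrt u + sqrt v) * \<bar>sqrt u - sqrt v\<bar>"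
    using assms False by (intro mult_right_mono) auto
  also have "\<dots> = \<bar>(sqrt u + sqrt v) * (sqrt u - sqrt v)\<bar>"
    using assms by (simp add: abs_mult)
  also have "\<dots> = \<bar>u - v\<bar>"
    using assms by (simp add: algebra_simps)
  finally show ?thesis using assms by (simp add: pos_le_divide_eq mult.commute)
qed (use assms in simp)

lemma ACG_on_sqrt_infdist: "ACG_on a b (\<lambda>x. sqrt (infdist x P))"
  unfolding ACG_on_def
proof (intro exI conjI allI)
  define E where "E n = {x \<in> {a..b}. infdist x P = 0 \<or> 1 / real (Suc n) \<le> infdist x P}" for n
  show "{a..b} = (\<Union>n. E n)"
  proof -
    have "\<exists>n. infdist x P = 0 \<or> 1 / real (Suc n) \<le> infdist x P" for x
    proof (cases "infdist x P = 0")
      case False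
      then have "infdist x P > 0" using infdist_nonneg[of x P] by linarith
      then obtain n where "inverse (real (Suc n)) < infdist x P"
        using reals_Archimedean by blast
      then show ?thesis by (intro exI[of _ n]) (simp add: inverse_eq_divide)
    qed simp
    then show ?thesis by (auto simp: E_def)
  qed
  fix n
  let ?c = "sqrt (1 / real (Suc n))"
  have "(1 / ?c)-lipschitz_on (E n) (\<lambda>x. sqrt (infdist x P))"
  proof (rule lipschitz_onI)
    fix x y assume xy: "x \<in> E n" "y \<in> E n"
    have big: "?c \<le> sqrt (infdist z P)" if "z \<in> E n" "infdist z P \<noteq> 0" for z
      using that by (intro real_sqrt_le_mono) (auto simp: E_def)
    have pos: "?c > 0" by simp
    have "infdist x P = infdist y P \<or> ?c \<le> sqrt (infdist x P) + sqrt (infdist y P)"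
    proof (cases "infdist x P = 0")
      case True
      then show ?thesis using big[OF xy(2)] by (cases "infdist y P = 0") auto
    next
      case False
      then show ?thesis using big[OF xy(1)]
        by (intro disjI2 add_increasing2) (simp_all add: infdist_nonneg)
    qed
    then have "\<bar>sqrt (infdist x P) - sqrt (infdist y P)\<bar> \<le> \<bar>infdist x P - infdist y P\<bar> / ?c"
      using pos by (intro abs_sqrt_diff_le infdist_nonneg)
    also have "\<dots> \<le> dist x y / ?c"
      using infdist_triangle_abs[of x P y] pos by (intro divide_right_mono) auto
    finally show "dist (sqrt (infdist x P)) (sqrt (infdist y P)) \<le> 1 / ?c * dist x y"
      by (simp add: dist_real_def)
  qed simp
  then show "AC_on (E n) (\<lambda>x. sqrt (infdist x P))" by (rule lipschitz_on_imp_AC_on)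
qed

section \<open>Failure of differentiability at points with large nearby holes\<close>

text \<open>
  Continuity serves to make \<open>g\<close> integrable: the Bochner integral of a non-integrable function
  is 0, and the bound could fail for it.
\<close>

lemma set_integral_ge_const:
  fixes g :: "real \<Rightarrow> real"
  assumes cont: "continuous_on {p..q} g" and nonneg: "\<And>t. t \<in> {p..q} \<Longrightarrow> 0 \<le> g t"
    and sub: "{u..v} \<subseteq> {p..q}" and "u \<le> v"
    and ge: "\<And>t. t \<in> {u..v} \<Longrightarrow> m \<le> g t"
  shows "(v - u) * m \<le> (LINT t:{p..q}|lebesgue. g t)"
proof -
  have int: "set_integrable lebesgue {p..q} g"
    using absolutely_integrable_continuous_real[OF cont] .
  have "(v - u) * m = (LINT t:{u..v}|lebesgue. m)"
    using \<open>u \<le> v\<close> by (simp add: set_lebesgue_integral_def)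
  also have "\<dots> \<le> (LINT t:{p..q}|lebesgue. g t)"
    unfolding set_lebesgue_integral_def
  proof (rule integral_mono)
    show "integrable lebesgue (\<lambda>t. indicat_real {u..v} t *\<^sub>R m)"
      using absolutely_integrable_continuous_real[of u v "\<lambda>_. m"]
      by (simp add: set_integrable_def)
    show "integrable lebesgue (\<lambda>t. indicat_real {p..q} t *\<^sub>R g t)"
      using int by (simp add: set_integrable_def)
    show "indicat_real {u..v} t *\<^sub>R m \<le> indicat_real {p..q} t *\<^sub>R g t" for t
      using sub ge[of t] nonneg[of t] by (auto simp: indicator_def)
  qed
  finally show ?thesis .
qed

text \<open>
  The single assumption \<open>large\<close> does both jobs. It makes the contribution of the hole to the mean
  too large, and, since \<open>w \<le> h\<close>, it also makes \<open>sqrt w / h\<close> tend to infinity, so that the linear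
  term is negligible on the hole whatever its slope. As \<open>w / h \<le> 1\<close>, the factor
  \<open>(w / h) powr (1 / r)\<close> is smallest for \<open>r = 1\<close>, and so one condition covers all exponents.
\<close>

lemma not_Lr_differentiable_sqrt_infdist:
  fixes h w c :: "nat \<Rightarrow> real"
  assumes "1 \<le> r" and "x \<in> P"
    and h: "h \<longlonglongrightarrow> 0" "\<And>n. 0 < h n"
    and w: "\<And>n. 0 < w n" "\<And>n. w n \<le> h n"
    and hole: "\<And>n. {c n..c n + w n} \<subseteq> {x - h n..x + h n}"
      "\<And>n y. y \<in> {c n..c n + w n} \<Longrightarrow> w n \<le> infdist y P"
    and large: "filterlim (\<lambda>n. w n * sqrt (w n) / (h n)\<^sup>2) at_top sequentially"
  shows "\<not> Lr_differentiable r (\<lambda>y. sqrt (infdist y P)) x"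
proof
  assume "Lr_differentiable r (\<lambda>y. sqrt (infdist y P)) x"
  then obtain \<alpha> where
    \<alpha>: "(\<lambda>h. (1 / h * (LINT t:{-h..h}|lebesgue.
          \<bar>sqrt (infdist (x + t) P) - \<alpha> * t\<bar> powr r)) powr (1 / r)) \<in> o[at_right 0](\<lambda>h. h)"
    using \<open>x \<in> P\<close> by (auto simp: Lr_differentiable_def)
  define I where "I h = (LINT t:{-h..h}|lebesgue.
    \<bar>sqrt (infdist (x + t) P) - \<alpha> * t\<bar> powr r)" for h
  have "\<forall>\<^sub>F h in at_right 0. norm ((1 / h * I h) powr (1 / r)) \<le> 1 * norm h"
    using landau_o.smallD[OF \<alpha>, of 1] by (simp add: I_def)
  moreover have "filterlim h (at_right 0) sequentially"
    using h by (intro filterlim_at_withinI always_eventually) (auto simp: less_imp_neq[symmetric])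
  ultimately have "\<forall>\<^sub>F n in sequentially. norm ((1 / h n * I (h n)) powr (1 / r)) \<le> 1 * norm (h n)"
    by (rule eventually_compose_filterlim)
  moreover have "\<forall>\<^sub>F n in sequentially. max 2 (2 * \<bar>\<alpha>\<bar>) < w n * sqrt (w n) / (h n)\<^sup>2"
    using large unfolding filterlim_at_top_dense by (rule spec)
  ultimately have "\<forall>\<^sub>F n in sequentially. norm ((1 / h n * I (h n)) powr (1 / r)) \<le> 1 * norm (h n)
      \<and> max 2 (2 * \<bar>\<alpha>\<bar>) < w n * sqrt (w n) / (h n)\<^sup>2"
    by (rule eventually_conj)
  then obtain n where n: "(1 / h n * I (h n)) powr (1 / r) \<le> h n"
      and big: "max 2 (2 * \<bar>\<alpha>\<bar>) < w n * sqrt (w n) / (h n)\<^sup>2"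
    using h(2) by (auto simp: eventually_sequentially less_imp_le)
  define H W s where "H = h n" and "W = w n" and "s = sqrt (w n)"
  have pos: "0 < H" "0 < W" "W \<le> H" "0 < s" "s\<^sup>2 = W"
    using h(2) w by (auto simp: H_def W_def s_def less_imp_le)
  have big2: "2 * H\<^sup>2 < W * s" and big\<alpha>: "2 * \<bar>\<alpha>\<bar> * H\<^sup>2 < W * s"
    using big pos by (auto simp: H_def W_def s_def field_simps)
  \<comment> \<open>The linear term stays below half of the value \<open>s\<close> that the function has on the hole.\<close>
  have "2 * \<bar>\<alpha>\<bar> * H * H \<le> s * H"
  proof -
    have "W * s \<le> H * s" using pos by (intro mult_right_mono) auto
    with big\<alpha> show ?thesis by (simp add: power2_eq_square mult_ac)
  qed
  then have \<alpha>H: "\<bar>\<alpha>\<bar> * H \<le> s / 2" using pos by simp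
  define u where "u = c n - x"
  have "(u + W - u) * (s / 2) powr r \<le> I H"
    unfolding I_def
  proof (rule set_integral_ge_const)
    show "continuous_on {- H..H} (\<lambda>t. \<bar>sqrt (infdist (x + t) P) - \<alpha> * t\<bar> powr r)"
      using \<open>1 \<le> r\<close> by (intro continuous_on_powr' continuous_intros) auto
    have "c n \<in> {c n..c n + w n}" "c n + w n \<in> {c n..c n + w n}"
      using w(1)[of n] by auto
    then have "c n \<in> {x - h n..x + h n}" "c n + w n \<in> {x - h n..x + h n}"
      using hole(1)[of n] by blast+
    then show sub: "{u..u + W} \<subseteq> {- H..H}"
      by (auto simp: u_def H_def W_def)
    fix t assume t: "t \<in> {u..u + W}"
    then have "w n \<le> infdist (x + t) P"
      by (intro hole(2)) (auto simp: u_def W_def)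
    then have "s \<le> sqrt (infdist (x + t) P)" unfolding s_def by (rule real_sqrt_le_mono)
    moreover have "\<bar>\<alpha> * t\<bar> \<le> \<bar>\<alpha>\<bar> * H"
      using t sub unfolding abs_mult by (intro mult_left_mono) auto
    ultimately have "s / 2 \<le> \<bar>sqrt (infdist (x + t) P) - \<alpha> * t\<bar>"
      using \<alpha>H by linarith
    then show "(s / 2) powr r \<le> \<bar>sqrt (infdist (x + t) P) - \<alpha> * t\<bar> powr r"
      using pos \<open>1 \<le> r\<close> by (intro powr_mono2) auto
  qed (use pos in auto)
  then have "1 / H * (W * (s / 2) powr r) \<le> 1 / H * I H"
    using pos by (intro mult_left_mono) auto
  then have "(1 / H * (W * (s / 2) powr r)) powr (1 / r) \<le> (1 / H * I H) powr (1 / r)"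
    using pos \<open>1 \<le> r\<close> by (intro powr_mono2) auto
  also have "\<dots> \<le> H" using n by (simp add: H_def)
  also have "(1 / H * (W * (s / 2) powr r)) powr (1 / r) = (W / H) powr (1 / r) * (s / 2)"
    using pos \<open>1 \<le> r\<close> powr_mult[of "W / H" "(s / 2) powr r" "1 / r"] by (simp add: powr_powr)
  finally have "(W / H) powr (1 / r) * (s / 2) \<le> H" .
  moreover have "W / H \<le> (W / H) powr (1 / r)"
    using powr_mono'[of "1 / r" 1 "W / H"] pos \<open>1 \<le> r\<close> by simp
  ultimately have "W / H * (s / 2) \<le> H"
    using pos mult_right_mono[of "W / H" "(W / H) powr (1 / r)" "s / 2"] by linarith
  then show False using pos big2 by (simp add: field_simps power2_eq_square)
qed

section \<open>A set of positive measure with large holes at every scale\<close>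

text \<open>
  The radius is twice the length \<open>w = (b - a) / 64 ^ Suc n\<close> of the intervals on which the distance
  to the perforated set has to be at least \<open>w\<close>, because only points at distance at most \<open>w\<close> from the centre are sure to be at distance at
  least \<open>w\<close> from the complement of the ball.
\<close>

definition hole_radius :: "real \<Rightarrow> real \<Rightarrow> nat \<Rightarrow> real" where
  "hole_radius a b n = (b - a) / (32 * 64 ^ n)"

definition holes :: "real \<Rightarrow> real \<Rightarrow> nat \<Rightarrow> real set" where
  "holes a b n = (\<Union>k\<le>32 ^ n. ball (a + real k * ((b - a) / 32 ^ n)) (hole_radius a b n))"

definition perforated :: "real \<Rightarrow> real \<Rightarrow> real set" where
  "perforated a b = {a..b} - (\<Union>n. holes a b n)"

lemma hole_radius_pos: "a < b \<Longrightarrow> 0 < hole_radius a b n"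
  by (simp add: hole_radius_def)

lemma open_holes: "open (holes a b n)"
  by (auto simp: holes_def)

lemma sets_perforated: "perforated a b \<in> sets lebesgue"
  unfolding perforated_def using open_holes by (intro sets.Diff sets.countable_UN) auto

text \<open>
  There are \<open>32 ^ n + 1 \<le> 2 * 32 ^ n\<close> balls, each of length \<open>(b - a) / (16 * 64 ^ n)\<close>.
  The bounds add up to \<open>(b - a) / 4\<close>, so most of \<open>[a, b]\<close> survives the removal of all the holes.
\<close>

lemma emeasure_holes_le:
  assumes "a < b"
  shows "emeasure lebesgue (holes a b n) \<le> ennreal ((b - a) / 8 * (1 / 2) ^ n)"
proof -
  have "emeasure lebesgue (holes a b n) \<le>
      (\<Sum>k\<le>32 ^ n. emeasure lebesgue (ball (a + real k * ((b - a) / 32 ^ n)) (hole_radius a b n)))"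
    unfolding holes_def by (rule emeasure_subadditive_finite) auto
  also have "\<dots> = (\<Sum>k\<le>(32::nat) ^ n. ennreal (2 * hole_radius a b n))"
    using hole_radius_pos[OF assms, of n] by (simp add: ball_eq_greaterThanLessThan)
  also have "\<dots> = ennreal ((32 ^ n + 1) * (2 * hole_radius a b n))"
    using hole_radius_pos[OF assms, of n]
    by (subst sum_ennreal) (auto simp: algebra_simps)
  also have "\<dots> \<le> ennreal ((2 * 32 ^ n) * (2 * hole_radius a b n))"
    using hole_radius_pos[OF assms, of n]
    by (intro ennreal_leI mult_right_mono) auto
  also have "(2 * 32 ^ n) * (2 * hole_radius a b n) = (b - a) / 8 * (1 / 2) ^ n"
  proof -
    have "(64 :: real) ^ n = 2 ^ n * 32 ^ n" by (simp flip: power_mult_distrib)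
    then show ?thesis by (simp add: hole_radius_def power_divide divide_simps)
  qed
  finally show ?thesis .
qed

lemma emeasure_perforated_pos:
  assumes "a < b"
  shows "emeasure lebesgue (perforated a b) > 0"
proof (rule ccontr)
  assume "\<not> emeasure lebesgue (perforated a b) > 0"
  then have zero: "emeasure lebesgue (perforated a b) = 0" by simp
  have meas: "(\<Union>n. holes a b n) \<in> sets lebesgue" using open_holes by (intro sets.countable_UN) auto
  have sums: "(\<lambda>n. (b - a) / 8 * (1 / 2) ^ n) sums ((b - a) / 8 * 2)"
    using sums_mult[OF geometric_sums[of "1 / 2 :: real"], of "(b - a) / 8"] by simp
  have "ennreal (b - a) = emeasure lebesgue {a..b}" using assms by simp
  also have "\<dots> \<le> emeasure lebesgue (perforated a b \<union> (\<Union>n. holes a b n))"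
    using sets_perforated meas by (intro emeasure_mono) (auto simp: perforated_def)
  also have "\<dots> \<le> emeasure lebesgue (perforated a b) + emeasure lebesgue (\<Union>n. holes a b n)"
    using sets_perforated meas by (intro emeasure_subadditive)
  also have "\<dots> \<le> (\<Sum>n. emeasure lebesgue (holes a b n))"
    unfolding zero using open_holes by (auto intro!: emeasure_subadditive_countably)
  also have "\<dots> \<le> (\<Sum>n. ennreal ((b - a) / 8 * (1 / 2) ^ n))"
    by (intro suminf_le emeasure_holes_le assms) auto
  also have "\<dots> = ennreal ((b - a) / 8 * 2)"
    using sums assms by (intro suminf_ennreal_eq) auto
  finally show False using assms by (simp add: ennreal_le_iff)
qed

text \<open>The balls of generation 0 are centred at \<open>a\<close> and \<open>b\<close> and remove the endpoints.\<close>

lemma perforated_subset: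
  assumes "a < b"
  shows "perforated a b \<subseteq> {a<..<b}"
proof
  fix x assume x: "x \<in> perforated a b"
  then have "x \<notin> holes a b 0" "x \<in> {a..b}" by (auto simp: perforated_def)
  moreover have "a \<in> holes a b 0" "b \<in> holes a b 0"
    using hole_radius_pos[OF assms, of 0] by (auto simp: holes_def atMost_Suc)
  ultimately have "x \<noteq> a" "x \<noteq> b" "x \<in> {a..b}" by auto
  then show "x \<in> {a<..<b}" by auto
qed

text \<open>
  The centre \<open>c\<close> is the last grid point of mesh \<open>h\<close> that does not exceed \<open>x\<close>. As \<open>x\<close> itself is not
  in the ball around \<open>c\<close>, the right half of this ball lies between \<open>c\<close> and \<open>x\<close>, hence within
  distance \<open>h\<close> of \<open>x\<close>, even when \<open>x\<close> is close to \<open>a\<close> or \<open>b\<close>; the interval sought is the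
  inner half of that right half.
\<close>

lemma perforated_hole_near:
  fixes a b :: real and n :: nat
  assumes "a < b" and x: "x \<in> perforated a b"
  defines "h \<equiv> (b - a) / 32 ^ n" and "w \<equiv> (b - a) / 64 ^ Suc n"
  shows "\<exists>c. {c..c + w} \<subseteq> {x - h..x + h} \<and> (\<forall>y\<in>{c..c + w}. w \<le> infdist y (perforated a b))"
proof -
  define k where "k = nat \<lfloor>(x - a) / h\<rfloor>"
  define c where "c = a + real k * h"
  have ab: "a \<le> x" "x \<le> b" using x by (auto simp: perforated_def)
  have pos: "0 < h" "0 < w" using assms by (auto simp: h_def w_def)
  have d: "hole_radius a b n = 2 * w" by (simp add: hole_radius_def w_def field_simps)
  have kle: "real k \<le> (x - a) / h" and "(x - a) / h < real k + 1"
    using ab pos by (auto simp: k_def)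
  then have c: "c \<le> x" "x < c + h" using pos by (auto simp: c_def field_simps)
  have "(x - a) / h \<le> (b - a) / h" using ab pos by (intro divide_right_mono) auto
  also have "\<dots> = 32 ^ n" using assms by (simp add: h_def)
  finally have "real k \<le> 32 ^ n" using kle by linarith
  then have "real k \<le> real (32 ^ n)" by simp
  then have k: "k \<le> 32 ^ n" by (simp only: of_nat_le_iff)
  have "ball c (2 * w) \<subseteq> holes a b n"
    unfolding holes_def d c_def h_def using k by blast
  then have away: "2 * w \<le> \<bar>p - c\<bar>" if "p \<in> perforated a b" for p
    using that by (force simp: perforated_def dist_real_def)
  show ?thesis
  proof (intro exI conjI ballI)
    show "{c..c + w} \<subseteq> {x - h..x + h}"
      using c away[OF x] pos by auto
    fix y assume y: "y \<in> {c..c + w}"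
    have ne: "perforated a b \<noteq> {}" using x by auto
    show "w \<le> infdist y (perforated a b)"
      unfolding infdist_notempty[OF ne]
    proof (rule cINF_greatest[OF ne])
      fix p assume "p \<in> perforated a b"
      then show "w \<le> dist y p" using away[of p] y by (auto simp: dist_real_def)
    qed
  qed
qed

theorem theorem17:
  fixes a b :: real
  assumes "a < b"
  shows "\<exists>F :: real \<Rightarrow> real.
           continuous_on {a..b} F \<and> ACG_on a b F \<and>
           (\<forall>r::real. 1 \<le> r \<longrightarrow>
              (\<exists>S \<in> sets lebesgue. S \<subseteq> {a<..<b} \<and> emeasure lebesgue S > 0 \<and>
                 (\<forall>x\<in>S. \<not> Lr_differentiable r F x)))"
proof -
  define P where "P = perforated a b"
  define h w where "h n = (b - a) / 32 ^ n" and "w n = (b - a) / 64 ^ Suc n" for n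
  have "\<not> Lr_differentiable r (\<lambda>y. sqrt (infdist y P)) x" if "1 \<le> r" "x \<in> P" for r x
  proof -
    from perforated_hole_near[OF assms that(2)[unfolded P_def]] obtain c where c:
      "\<And>n. {c n..c n + w n} \<subseteq> {x - h n..x + h n}"
      "\<And>n y. y \<in> {c n..c n + w n} \<Longrightarrow> w n \<le> infdist y P"
      unfolding h_def w_def P_def by metis
    show ?thesis
    proof (rule not_Lr_differentiable_sqrt_infdist[OF that _ _ _ _ c])
      show "h \<longlonglongrightarrow> 0"
        using tendsto_mult[OF tendsto_const LIMSEQ_power_zero[of "1 / 32 :: real"], of "b - a"]
        by (simp add: h_def[abs_def] power_divide)
      show "0 < h n" "0 < w n" for n using assms by (auto simp: h_def w_def)
      show "w n \<le> h n" for n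
      proof -
        have "(32 :: real) ^ n \<le> 64 ^ Suc n"
          using power_mono[of "32 :: real" 64 n] zero_le_power[of "64 :: real" n] by (simp del: zero_le_power)
        then show ?thesis unfolding h_def w_def using assms by (intro divide_left_mono) auto
      qed
      have eq: "w n * sqrt (w n) / (h n)\<^sup>2 = 1 / (512 * sqrt (b - a)) * 2 ^ n" for n
      proof -
        define s where "s = sqrt (b - a)"
        have s: "s > 0" "b - a = s * s" using assms by (auto simp: s_def)
        have "w n = (s / 8 ^ Suc n)\<^sup>2"
          unfolding w_def s(2) power_divide
          by (simp add: power2_eq_square flip: power_mult_distrib)
        then have "sqrt (w n) = s / 8 ^ Suc n" using s by simp
        moreover have "(32::real) ^ n * 32 ^ n = 64 ^ n * 8 ^ n * 2 ^ n"
          by (simp flip: power_mult_distrib)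
        ultimately show ?thesis
          using s(1) unfolding h_def w_def s_def[symmetric] s(2)
          by (simp add: field_simps power2_eq_square)
      qed
      have "filterlim (\<lambda>n. 2 ^ n :: real) at_top sequentially"
        by (rule filterlim_at_top_mono[OF filterlim_real_sequentially])
          (auto intro!: always_eventually less_imp_le of_nat_less_two_power)
      then show "filterlim (\<lambda>n. w n * sqrt (w n) / (h n)\<^sup>2) at_top sequentially"
        unfolding eq using assms
        by (intro filterlim_tendsto_pos_mult_at_top[OF tendsto_const]) auto
    qed
  qed
  moreover have "continuous_on {a..b} (\<lambda>y. sqrt (infdist y P))"
    by (intro continuous_intros)
  ultimately show ?thesis
    using ACG_on_sqrt_infdist[of a b P] sets_perforated[of a b] perforated_subset[OF assms]
      emeasure_perforated_pos[OF assms]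
    unfolding P_def by blast
qed

end
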